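(* Let $\mu:\mathbb{D}\to\mathbb{B}$ be such that there exists a real constant $c$ with $\|\mu\|_{L^\infty(\mathbb{D},\mathbb{B})}\le c<1$. Every solution $w:\mathbb{D}\to\mathbb{B}$ of $\bar\partial w=\mu\,\partial w$ has the form $w=p^+w^++p^-w^-$, where $w^+:\mathbb{D}\to\mathbb{C}$ solves the $\mathbb{C}$-Beltrami equation $$\frac{\partial (w^+)^*}{\partial z^*}=(\mu^+)^*\,\frac{\partial (w^+)^*}{\partial z}$$ and $w^-:\mathbb{D}\to\mathbb{C}$ solves the $\mathbb{C}$-Beltrami equation $$\frac{\partial w^-}{\partial z^*}=\mu^-\,\frac{\partial w^-}{\partial z}.$$
   Context: $\mathbb{D}$ is the unit disk in $\mathbb{C}$, $z=x+iy$; $z^*=x-iy$ denotes complex conjugation; $\frac{\partial}{\partial z}=\frac12(\partial_x-i\partial_y)$, $\frac{\partial}{\partial z^*}=\frac12(\partial_x+i\partial_y)$. The bicomplex numbers $\mathbb{B}=\{z_1+jz_2: z_1,z_2\in\mathbb{C}\}$ form the commutative $\mathbb{C}$-algebra with $j^2=-1$, $ij=ji$. Put $p^\pm=\frac12(1\pm ji)$; these satisfy $(p^\pm)^2=p^\pm$, $p^+p^-=0$, $p^++p^-=1$. Every $w=z_1+jz_2\in\mathbb{B}$ is uniquely $w=p^+w^++p^-w^-$ with $w^\pm=z_1\mp iz_2\in\mathbb{C}$; for $\mathbb{B}$-valued functions the notation $w^\pm,\mu^\pm$ is applied pointwise. Norm: $\|w\|_{\mathbb{B}}=\sqrt{(|w^+|^2+|w^-|^2)/2}$,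 and $\|\mu\|_{L^\infty(\mathbb{D},\mathbb{B})}=\sup_{z\in\mathbb{D}}\|\mu(z)\|_{\mathbb{B}}$. The bicomplex operators are $\partial=\frac12(\partial_x-j\partial_y)$ and $\bar\partial=\frac12(\partial_x+j\partial_y)$. A $\mathbb{C}$-Beltrami equation is any equation of the form $\frac{\partial v}{\partial z^*}=\nu\frac{\partial v}{\partial z}$ with $\nu\in L^\infty(\mathbb{D})$ complex-valued for which there is a positive constant $c$ with $\|\nu\|_{L^\infty(\mathbb{D})}\le c<1$.
   Formalization: That both coefficients have sup norm below 1 is concluded only if √2·c<1 (for c<1 only the bound √2·c is shown): it fails for μ=(6/5)p⁺, w=0, where ‖μ‖<1 but μ⁺=6/5. The decomposition and both equations hold without this condition. *)

theory Defs
  imports "HOL-Analysis.Analysis"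
begin

section \<open>Bicomplex numbers\<close>

text \<open>\<^term>\<open>BC z1 z2\<close> stands for \<open>z1 + j z2\<close>.\<close>

datatype bicomplex = BC (bc_fst: complex) (bc_snd: complex)

text \<open>The components \<open>w\<^sup>+\<close> and \<open>w\<^sup>-\<close> of a bicomplex number \<open>w\<close>.\<close>

definition bc_plus :: "bicomplex \<Rightarrow> complex" where
  "bc_plus w = bc_fst w - \<i> * bc_snd w"

definition bc_minus :: "bicomplex \<Rightarrow> complex" where
  "bc_minus w = bc_fst w + \<i> * bc_snd w"

instantiation bicomplex :: comm_ring_1
begin
definition "0 = BC 0 0"
definition "1 = BC 1 0"
definition "u + v = BC (bc_fst u + bc_fst v) (bc_snd u + bc_snd v)"
definition "- u = BC (- bc_fst u) (- bc_snd u)"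
definition "u - v = BC (bc_fst u - bc_fst v) (bc_snd u - bc_snd v)"
definition "u * v = BC (bc_fst u * bc_fst v - bc_snd u * bc_snd v)
                       (bc_fst u * bc_snd v + bc_snd u * bc_fst v)"
instance
  by standard
    (auto simp: zero_bicomplex_def one_bicomplex_def plus_bicomplex_def uminus_bicomplex_def
      minus_bicomplex_def times_bicomplex_def algebra_simps)
end

text \<open>The inner product is the one that induces the given norm; together with the basis
  it provides Borel sets, integration and differentiation of bicomplex-valued functions.\<close>

instantiation bicomplex :: real_inner
begin
definition "r *\<^sub>R u = BC (r *\<^sub>R bc_fst u) (r *\<^sub>R bc_snd u)"
definition "norm u = sqrt (((cmod (bc_plus u))\<^sup>2 + (cmod (bc_minus u))\<^sup>2) / 2)"
definition "dist u v = norm (u - v :: bicomplex)"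
definition "sgn u = inverse (norm u) *\<^sub>R (u :: bicomplex)"
definition "inner u v = inner (bc_fst u) (bc_fst v) + inner (bc_snd u) (bc_snd v)"
definition [code del]:
  "(uniformity :: (bicomplex \<times> bicomplex) filter) = (INF e\<in>{0<..}. principal {(u, v). dist u v < e})"
definition [code del]:
  "open (U :: bicomplex set) \<longleftrightarrow>
     (\<forall>u\<in>U. eventually (\<lambda>(u', v). u' = u \<longrightarrow> v \<in> U) uniformity)"
instance
proof
  fix u v w :: bicomplex and a b :: real and U :: "bicomplex set"
  show "a *\<^sub>R (u + v) = a *\<^sub>R u + a *\<^sub>R v" "(a + b) *\<^sub>R u = a *\<^sub>R u + b *\<^sub>R u"
    "a *\<^sub>R b *\<^sub>R u = (a * b) *\<^sub>R u" "1 *\<^sub>R u = u"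
    by (auto simp: scaleR_bicomplex_def plus_bicomplex_def algebra_simps)
  show "dist u v = norm (u - v)" by (rule dist_bicomplex_def)
  show "sgn u = inverse (norm u) *\<^sub>R u" by (rule sgn_bicomplex_def)
  show "inner u v = inner v u" "inner (u + v) w = inner u w + inner v w"
    "inner (a *\<^sub>R u) v = a * inner u v" "0 \<le> inner u u"
    by (auto simp: inner_bicomplex_def scaleR_bicomplex_def plus_bicomplex_def
        inner_commute inner_add_left algebra_simps)
  show "inner u u = 0 \<longleftrightarrow> u = 0"
    by (cases u) (auto simp: inner_bicomplex_def zero_bicomplex_def add_nonneg_eq_0_iff)
  have "((cmod (bc_plus u))\<^sup>2 + (cmod (bc_minus u))\<^sup>2) / 2 = inner u u"
    unfolding bc_plus_def bc_minus_def inner_bicomplex_def inner_complex_def cmod_power2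
    by (simp add: power2_eq_square algebra_simps)
  then show "norm u = sqrt (inner u u)"
    by (simp add: norm_bicomplex_def)
qed (rule uniformity_bicomplex_def open_bicomplex_def)+
end

instantiation bicomplex :: euclidean_space
begin
definition "Basis = {BC 1 0, BC \<i> 0, BC 0 1, BC 0 \<i>}"
instance
  by standard
    (auto simp: Basis_bicomplex_def inner_bicomplex_def zero_bicomplex_def inner_complex_def
      complex_eq_iff bicomplex.expand split: if_splits)
end

definition bc_of_complex :: "complex \<Rightarrow> bicomplex" where
  "bc_of_complex a = BC a 0"

definition bc_j :: bicomplex where
  "bc_j = BC 0 1"

definition p_plus :: bicomplex where
  "p_plus = (1 / 2) *\<^sub>R (1 + bc_j * bc_of_complex \<i>)"

definition p_minus :: bicomplex where
  "p_minus = (1 / 2) *\<^sub>R (1 - bc_j * bc_of_complex \<i>)"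


section \<open>Bounded functions on the unit disk\<close>

abbreviation unit_disk :: "complex set" where
  "unit_disk \<equiv> ball 0 1"

definition Linf_disk :: "(complex \<Rightarrow> 'a::euclidean_space) set" where
  "Linf_disk = {f. f \<in> borel_measurable (lebesgue_on unit_disk) \<and> bounded (f ` unit_disk)}"

text \<open>This is the supremum over all points. It is meaningful only for members of
  \<^const>\<open>Linf_disk\<close>; the supremum of an unbounded set of reals is unspecified.\<close>

definition Linf_norm :: "(complex \<Rightarrow> 'a::euclidean_space) \<Rightarrow> real" where
  "Linf_norm f = (SUP z\<in>unit_disk. norm (f z))"


section \<open>Partial derivatives in the pointwise and in the weak sense\<close>

definition pointwise_partials ::
  "complex set \<Rightarrow> (complex \<Rightarrow> 'a::real_normed_vector) \<Rightarrow> (complex \<Rightarrow> 'a) \<Rightarrow> (complex \<Rightarrow> 'a) \<Rightarrow> bool"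
  where
  "pointwise_partials S f fx fy \<longleftrightarrow>
     (\<forall>z\<in>S. ((\<lambda>t. f (z + of_real t)) has_vector_derivative fx z) (at 0) \<and>
            ((\<lambda>t. f (z + \<i> * of_real t)) has_vector_derivative fy z) (at 0))"

primrec Ck_fun :: "nat \<Rightarrow> (complex \<Rightarrow> real) \<Rightarrow> bool" where
  "Ck_fun 0 f \<longleftrightarrow> continuous_on UNIV f"
| "Ck_fun (Suc k) f \<longleftrightarrow> (\<exists>fx fy. pointwise_partials UNIV f fx fy \<and> Ck_fun k fx \<and> Ck_fun k fy)"

definition test_function :: "(complex \<Rightarrow> real) \<Rightarrow> bool" where
  "test_function \<phi> \<longleftrightarrow> (\<forall>k. Ck_fun k \<phi>) \<and>
     compact (closure {z. \<phi> z \<noteq> 0}) \<and> closure {z. \<phi> z \<noteq> 0} \<subseteq> unit_disk"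

definition locally_integrable :: "(complex \<Rightarrow> 'a::euclidean_space) \<Rightarrow> bool" where
  "locally_integrable f \<longleftrightarrow> (\<forall>K. compact K \<and> K \<subseteq> unit_disk \<longrightarrow> integrable (lebesgue_on K) f)"

definition weak_partials ::
  "(complex \<Rightarrow> 'a::euclidean_space) \<Rightarrow> (complex \<Rightarrow> 'a) \<Rightarrow> (complex \<Rightarrow> 'a) \<Rightarrow> bool" where
  "weak_partials f fx fy \<longleftrightarrow>
     locally_integrable f \<and> locally_integrable fx \<and> locally_integrable fy \<and>
     (\<forall>\<phi> \<phi>x \<phi>y. test_function \<phi> \<and> pointwise_partials UNIV \<phi> \<phi>x \<phi>y \<longrightarrow>
        integral\<^sup>L (lebesgue_on unit_disk) (\<lambda>z. \<phi>x z *\<^sub>R f z) =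
          - integral\<^sup>L (lebesgue_on unit_disk) (\<lambda>z. \<phi> z *\<^sub>R fx z) \<and>
        integral\<^sup>L (lebesgue_on unit_disk) (\<lambda>z. \<phi>y z *\<^sub>R f z) =
          - integral\<^sup>L (lebesgue_on unit_disk) (\<lambda>z. \<phi> z *\<^sub>R fy z))"

text \<open>A solution is either a function whose partial derivatives exist at every point of the
  disk and that satisfies the equation at every point, or a function with locally integrable
  weak partial derivatives that satisfies the equation almost everywhere. The following type
  lets one definition of each equation serve both notions.\<close>

datatype solution_sense = Pointwise | Weak

fun has_partials ::
  "solution_sense \<Rightarrow> (complex \<Rightarrow> 'a::euclidean_space) \<Rightarrow> (complex \<Rightarrow> 'a) \<Rightarrow> (complex \<Rightarrow> 'a) \<Rightarrow> bool"
  where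
  "has_partials Pointwise f fx fy = pointwise_partials unit_disk f fx fy"
| "has_partials Weak f fx fy = weak_partials f fx fy"

fun holds_on_disk :: "solution_sense \<Rightarrow> (complex \<Rightarrow> bool) \<Rightarrow> bool" where
  "holds_on_disk Pointwise P = (\<forall>z\<in>unit_disk. P z)"
| "holds_on_disk Weak P = (AE z in lebesgue_on unit_disk. P z)"


section \<open>The Beltrami equations\<close>

text \<open>The operators \<open>\<partial>/\<partial>z\<close>, \<open>\<partial>/\<partial>z\<^sup>*\<close> and their bicomplex analogues,
  applied to a pair of partial derivatives.\<close>

definition d_z :: "(complex \<Rightarrow> complex) \<Rightarrow> (complex \<Rightarrow> complex) \<Rightarrow> complex \<Rightarrow> complex" where
  "d_z fx fy z = (1 / 2) *\<^sub>R (fx z - \<i> * fy z)"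

definition d_zbar :: "(complex \<Rightarrow> complex) \<Rightarrow> (complex \<Rightarrow> complex) \<Rightarrow> complex \<Rightarrow> complex" where
  "d_zbar fx fy z = (1 / 2) *\<^sub>R (fx z + \<i> * fy z)"

definition bc_d :: "(complex \<Rightarrow> bicomplex) \<Rightarrow> (complex \<Rightarrow> bicomplex) \<Rightarrow> complex \<Rightarrow> bicomplex" where
  "bc_d fx fy z = (1 / 2) *\<^sub>R (fx z - bc_j * fy z)"

definition bc_dbar :: "(complex \<Rightarrow> bicomplex) \<Rightarrow> (complex \<Rightarrow> bicomplex) \<Rightarrow> complex \<Rightarrow> bicomplex" where
  "bc_dbar fx fy z = (1 / 2) *\<^sub>R (fx z + bc_j * fy z)"

definition solves_bc_beltrami ::
  "solution_sense \<Rightarrow> (complex \<Rightarrow> bicomplex) \<Rightarrow> (complex \<Rightarrow> bicomplex) \<Rightarrow> bool" where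
  "solves_bc_beltrami s \<mu> w \<longleftrightarrow>
     (\<exists>wx wy. has_partials s w wx wy \<and>
        holds_on_disk s (\<lambda>z. bc_dbar wx wy z = \<mu> z * bc_d wx wy z))"

definition solves_beltrami ::
  "solution_sense \<Rightarrow> (complex \<Rightarrow> complex) \<Rightarrow> (complex \<Rightarrow> complex) \<Rightarrow> bool" where
  "solves_beltrami s \<nu> v \<longleftrightarrow>
     (\<exists>vx vy. has_partials s v vx vy \<and>
        holds_on_disk s (\<lambda>z. d_zbar vx vy z = \<nu> z * d_z vx vy z))"

text \<open>The requirement on the coefficient of a \<open>\<complex>\<close>-Beltrami equation. It is separate from
  the equation because \<open>\<parallel>\<mu>\<parallel> \<le> c < 1\<close> in the norm of \<^typ>\<open>bicomplex\<close> gives only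
  \<open>\<bar>\<mu>\<^sup>\<plusminus>\<bar> \<le> \<surd>2 c\<close>: the constant \<open>\<mu> = (6/5) p\<^sup>+\<close> has norm \<open>(6/5)/\<surd>2 < 1\<close> but \<open>\<mu>\<^sup>+ = 6/5\<close>.\<close>

definition beltrami_coefficient :: "(complex \<Rightarrow> complex) \<Rightarrow> bool" where
  "beltrami_coefficient \<nu> \<longleftrightarrow> \<nu> \<in> Linf_disk \<and> (\<exists>c>0. Linf_norm \<nu> \<le> c \<and> c < 1)"

end

(* The maps w -> w+ and w -> w- are complex algebra homomorphisms sending j to -i and i.
   They turn the bicomplex equation into a conjugate Beltrami equation for w+, which
   complex conjugation makes a Beltrami equation, and into a Beltrami equation for w-. All maps
   involved are bounded and real-linear, hence commute with both kinds of partial derivatives. *)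

theory Submission
  imports Defs
begin

section \<open>The components as algebra homomorphisms\<close>

text \<open>Evaluation of \<open>z1 + j z2\<close> at \<open>j = -\<i>\<close> and at
  \<open>j = \<i>\<close>: products are respected because both values square to -1, as j
  does.\<close>

lemma bc_components_simps:
  "bc_plus (u + v) = bc_plus u + bc_plus v" "bc_minus (u + v) = bc_minus u + bc_minus v"
  "bc_plus (u - v) = bc_plus u - bc_plus v" "bc_minus (u - v) = bc_minus u - bc_minus v"
  "bc_plus (u * v) = bc_plus u * bc_plus v" "bc_minus (u * v) = bc_minus u * bc_minus v"
  "bc_plus (r *\<^sub>R u) = r *\<^sub>R bc_plus u" "bc_minus (r *\<^sub>R u) = r *\<^sub>R bc_minus u"
  "bc_plus bc_j = - \<i>" "bc_minus bc_j = \<i>"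
  by (auto simp: bc_plus_def bc_minus_def plus_bicomplex_def minus_bicomplex_def
      times_bicomplex_def scaleR_bicomplex_def bc_j_def algebra_simps)

text \<open>The idempotents sum to 1, and j acts on \<open>p_plus\<close> as \<open>-\<i>\<close>
  and on \<open>p_minus\<close> as \<open>\<i>\<close>; the proof compares coordinates.\<close>

lemma bc_decomposition:
  "w = p_plus * bc_of_complex (bc_plus w) + p_minus * bc_of_complex (bc_minus w)"
  by (cases w) (simp add: p_plus_def p_minus_def bc_of_complex_def bc_plus_def bc_minus_def bc_j_def
      plus_bicomplex_def minus_bicomplex_def times_bicomplex_def scaleR_bicomplex_def
      one_bicomplex_def complex_eq_iff field_simps)

lemma bounded_linear_bc_plus: "bounded_linear bc_plus"
  by (auto intro!: linear_conv_bounded_linear[THEN iffD1] linearI simp: bc_components_simps)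

lemma bounded_linear_bc_minus: "bounded_linear bc_minus"
  by (auto intro!: linear_conv_bounded_linear[THEN iffD1] linearI simp: bc_components_simps)

text \<open>The factor \<open>sqrt 2\<close> undoes the halving in the norm, after which the other
  square is dropped. Multiples of \<open>p_plus\<close> attain equality.\<close>

lemma cmod_bc_plus_le: "cmod (bc_plus u) \<le> sqrt 2 * norm u"
proof -
  have "sqrt 2 * norm u = sqrt ((cmod (bc_plus u))\<^sup>2 + (cmod (bc_minus u))\<^sup>2)"
    unfolding norm_bicomplex_def by (simp flip: real_sqrt_mult)
  then show ?thesis by (simp add: real_le_rsqrt)
qed

lemma cmod_bc_minus_le: "cmod (bc_minus u) \<le> sqrt 2 * norm u"
proof -
  have "sqrt 2 * norm u = sqrt ((cmod (bc_plus u))\<^sup>2 + (cmod (bc_minus u))\<^sup>2)"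
    unfolding norm_bicomplex_def by (simp flip: real_sqrt_mult)
  then show ?thesis by (simp add: real_le_rsqrt)
qed

section \<open>Images of bounded functions and of partial derivatives under linear maps\<close>

lemma Linf_disk_bounded_linear:
  fixes L :: "'a::euclidean_space \<Rightarrow> 'b::euclidean_space"
  assumes "bounded_linear L" "f \<in> Linf_disk"
  shows "(\<lambda>z. L (f z)) \<in> Linf_disk"
proof -
  have "L \<in> borel_measurable borel"
    using assms(1) by (intro borel_measurable_continuous_onI linear_continuous_on)
  moreover have "bounded ((\<lambda>z. L (f z)) ` unit_disk)"
    using bounded_linear_image[OF _ assms(1)] assms(2) by (force simp: Linf_disk_def image_image)
  ultimately show ?thesis
    using assms(2) by (auto simp: Linf_disk_def)
qed

lemma Linf_norm_mono:
  fixes f :: "complex \<Rightarrow> 'a::euclidean_space" and g :: "complex \<Rightarrow> 'b::euclidean_space"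
  assumes "f \<in> Linf_disk" "\<And>z. norm (g z) \<le> B * norm (f z)" "0 \<le> B"
  shows "Linf_norm g \<le> B * Linf_norm f"
  unfolding Linf_norm_def
proof (rule cSUP_least)
  fix z :: complex assume z: "z \<in> unit_disk"
  \<comment> \<open>Only for a set bounded above is the real supremum known to be an upper
    bound.\<close>
  have "bdd_above ((\<lambda>z. norm (f z)) ` unit_disk)"
    using assms(1) by (auto simp: Linf_disk_def bounded_iff bdd_above_def)
  then have "norm (f z) \<le> (SUP z\<in>unit_disk. norm (f z))"
    using z by (intro cSUP_upper)
  then show "norm (g z) \<le> B * (SUP z\<in>unit_disk. norm (f z))"
    using assms(2)[of z] assms(3) by (meson mult_left_mono order_trans)
qed simp

lemma beltrami_coefficientI:
  assumes "\<nu> \<in> Linf_disk" "Linf_norm \<nu> \<le> c" "c < 1"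
  shows "beltrami_coefficient \<nu>"
  unfolding beltrami_coefficient_def
  \<comment> \<open>The definition asks for a positive bound, while \<open>c\<close> may be 0; the
    maximum with 1/2 is positive and stays below 1.\<close>
  using assms by (intro conjI exI[of _ "max c (1/2)"]) auto

section \<open>Pointwise partial derivatives\<close>

lemma pointwise_partials_bounded_linear:
  assumes "bounded_linear L" "pointwise_partials S f fx fy"
  shows "pointwise_partials S (\<lambda>z. L (f z)) (\<lambda>z. L (fx z)) (\<lambda>z. L (fy z))"
  using assms by (auto simp: pointwise_partials_def intro: bounded_linear.has_vector_derivative)

text \<open>Serves to identify the existentially quantified partials in \<open>Ck_fun\<close> with
  given ones.\<close>

lemma pointwise_partials_unique:
  assumes "pointwise_partials UNIV f fx fy" "pointwise_partials UNIV f gx gy"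
  shows "fx = gx" "fy = gy"
  using assms by (auto simp: pointwise_partials_def fun_eq_iff intro: vector_derivative_unique_at)

text \<open>The complement of the closed support is open, so \<open>f\<close> vanishes on a short
  segment through \<open>z\<close> in each coordinate direction.\<close>

lemma pointwise_partials_eq_0:
  assumes "pointwise_partials UNIV f fx fy" "z \<notin> closure {z. f z \<noteq> 0}"
  shows "fx z = 0" "fy z = 0"
proof -
  \<comment> \<open>The direction \<open>u\<close> stays free, to be taken as 1 for
    \<open>fx\<close> and as \<open>\<i>\<close> for \<open>fy\<close>.\<close>
  have *: "d = 0" if d: "((\<lambda>t. f (z + u * of_real t)) has_vector_derivative d) (at 0)" for u d
  proof -
    let ?l = "\<lambda>t::real. z + u * of_real t"
    let ?V = "?l -` (- closure {z. f z \<noteq> 0})"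
    have "open ?V"
      by (intro open_vimage continuous_intros) auto
    moreover have "0 \<in> ?V"
      using assms(2) by simp
    moreover have "0 = f (?l t)" if "t \<in> ?V" for t
    proof (rule ccontr)
      assume "0 \<noteq> f (?l t)"
      then have "?l t \<in> {z. f z \<noteq> 0}" by simp
      then have "?l t \<in> closure {z. f z \<noteq> 0}" by (rule subsetD[OF closure_subset])
      with that show False by simp
    qed
    ultimately have "((\<lambda>t. f (?l t)) has_vector_derivative 0) (at 0)"
      by (rule has_vector_derivative_transform_within_open[OF has_vector_derivative_const])
    with d show ?thesis by (rule vector_derivative_unique_at)
  qed
  show "fx z = 0" using assms(1) *[of 1 "fx z"] by (simp add: pointwise_partials_def)
  show "fy z = 0" using assms(1) *[of \<i> "fy z"] by (simp add: pointwise_partials_def)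
qed

section \<open>Test functions and weak partial derivatives\<close>

lemma test_function_continuous:
  assumes "test_function \<phi>" "pointwise_partials UNIV \<phi> \<phi>x \<phi>y"
  shows "continuous_on UNIV \<phi>" "continuous_on UNIV \<phi>x" "continuous_on UNIV \<phi>y"
proof -
  have "Ck_fun 0 \<phi>" "Ck_fun (Suc 0) \<phi>" using assms(1) unfolding test_function_def by blast+
  then show "continuous_on UNIV \<phi>" "continuous_on UNIV \<phi>x" "continuous_on UNIV \<phi>y"
    using pointwise_partials_unique[OF assms(2)] by auto
qed

text \<open>On the compact set \<open>K\<close> the weight \<open>g\<close> is bounded and
  \<open>f\<close> is integrable; off \<open>K\<close> the product is 0.\<close>

lemma integrable_scaleR_locally_integrable:
  fixes f :: "complex \<Rightarrow> 'a::euclidean_space"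
  assumes "locally_integrable f" "continuous_on UNIV g" "compact K" "K \<subseteq> unit_disk"
    and supp: "\<And>z. z \<notin> K \<Longrightarrow> g z = 0"
  shows "integrable (lebesgue_on unit_disk) (\<lambda>z. g z *\<^sub>R f z)"
proof -
  have K: "K \<in> sets lebesgue" using assms(3) by (simp add: compact_imp_closed)
  have fK: "integrable (lebesgue_on K) f"
    using assms by (auto simp: locally_integrable_def)
  have "compact (g ` K)"
    using assms(2,3) by (meson compact_continuous_image continuous_on_subset subset_UNIV)
  then obtain B where "\<And>z. z \<in> K \<Longrightarrow> \<bar>g z\<bar> \<le> B"
    by (metis compact_imp_bounded bounded_iff imageI real_norm_def)
  \<comment> \<open>The dominating function is \<open>B *\<^sub>R f\<close>, whose norm contains
    \<open>\<bar>B\<bar>\<close>.\<close>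
  then have B: "\<And>z. z \<in> K \<Longrightarrow> \<bar>g z\<bar> \<le> \<bar>B\<bar>"
    by fastforce
  have "g \<in> borel_measurable (lebesgue_on K)"
    using K assms(2) by (meson continuous_imp_measurable_on_sets_lebesgue continuous_on_subset subset_UNIV)
  then have "integrable (lebesgue_on K) (\<lambda>z. g z *\<^sub>R f z)"
    using fK B
    by (intro Bochner_Integration.integrable_bound[OF integrable_scaleR_right[OF fK, of B]])
      (auto intro!: borel_measurable_scaleR AE_I2 mult_right_mono)
  \<comment> \<open>Passing to the whole plane turns the change of domain from \<open>K\<close> to
    the disk into an exchange of indicators.\<close>
  then have "integrable lebesgue (\<lambda>z. indicator K z *\<^sub>R (g z *\<^sub>R f z))"
    using K by (simp add: integrable_restrict_space)
  also have "(\<lambda>z. indicator K z *\<^sub>R (g z *\<^sub>R f z)) = (\<lambda>z. indicator unit_disk z *\<^sub>R (g z *\<^sub>R f z))"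
    using assms(4) supp by (auto simp: fun_eq_iff indicator_def)
  finally show ?thesis by (simp add: integrable_restrict_space)
qed

text \<open>A bounded linear map passes through the integrals against test functions and through the
  minus sign.\<close>

lemma weak_partials_bounded_linear:
  fixes L :: "'a::euclidean_space \<Rightarrow> 'b::euclidean_space"
  assumes L: "bounded_linear L" and w: "weak_partials f fx fy"
  shows "weak_partials (\<lambda>z. L (f z)) (\<lambda>z. L (fx z)) (\<lambda>z. L (fy z))"
proof -
  interpret L: bounded_linear L by (rule L)
  have loc: "locally_integrable f" "locally_integrable fx" "locally_integrable fy"
    using w unfolding weak_partials_def by blast+
  \<comment> \<open>Integrability has to be known here, since the integral of a non-integrable function is 0,
    whereas its image under \<^term>\<open>L\<close> may be integrable.\<close>
  have commute: "integral\<^sup>L (lebesgue_on unit_disk) (\<lambda>z. g z *\<^sub>R L (h z))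
      = L (integral\<^sup>L (lebesgue_on unit_disk) (\<lambda>z. g z *\<^sub>R h z))"
    if "locally_integrable h" "continuous_on UNIV g" "test_function \<phi>"
      "\<forall>z. z \<notin> closure {z. \<phi> z \<noteq> 0} \<longrightarrow> g z = 0" for g h \<phi>
  proof -
    have "compact (closure {z. \<phi> z \<noteq> 0})" "closure {z. \<phi> z \<noteq> 0} \<subseteq> unit_disk"
      using that(3) unfolding test_function_def by blast+
    from integral_bounded_linear[OF L integrable_scaleR_locally_integrable[OF that(1,2) this]] that(4)
    show ?thesis
      unfolding L.scaleR by blast
  qed
  show ?thesis
    unfolding weak_partials_def
  proof (intro conjI allI impI)
    show "locally_integrable (\<lambda>z. L (f z))" "locally_integrable (\<lambda>z. L (fx z))"
      "locally_integrable (\<lambda>z. L (fy z))"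
      using loc by (auto simp: locally_integrable_def intro: integrable_bounded_linear[OF L])
  next
    fix \<phi> \<phi>x \<phi>y assume A: "test_function \<phi> \<and> pointwise_partials UNIV \<phi> \<phi>x \<phi>y"
    then have t: "test_function \<phi>" and p: "pointwise_partials UNIV \<phi> \<phi>x \<phi>y" by auto
    note c = test_function_continuous[OF t p] 
    \<comment> \<open>All three weights vanish off the compact support of \<open>\<phi>\<close>, as
      \<open>commute\<close> demands.\<close>
    have z: "\<forall>z. z \<notin> closure {z. \<phi> z \<noteq> 0} \<longrightarrow> \<phi>x z = 0"
        "\<forall>z. z \<notin> closure {z. \<phi> z \<noteq> 0} \<longrightarrow> \<phi>y z = 0"
        "\<forall>z. z \<notin> closure {z. \<phi> z \<noteq> 0} \<longrightarrow> \<phi> z = 0"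
      using pointwise_partials_eq_0[OF p] subsetD[OF closure_subset, of _ "{z. \<phi> z \<noteq> 0}"]
      by blast+
    have eq: "integral\<^sup>L (lebesgue_on unit_disk) (\<lambda>z. \<phi>x z *\<^sub>R f z) =
          - integral\<^sup>L (lebesgue_on unit_disk) (\<lambda>z. \<phi> z *\<^sub>R fx z)"
        "integral\<^sup>L (lebesgue_on unit_disk) (\<lambda>z. \<phi>y z *\<^sub>R f z) =
          - integral\<^sup>L (lebesgue_on unit_disk) (\<lambda>z. \<phi> z *\<^sub>R fy z)"
      using w A unfolding weak_partials_def by blast+
    show "integral\<^sup>L (lebesgue_on unit_disk) (\<lambda>z. \<phi>x z *\<^sub>R L (f z)) =
          - integral\<^sup>L (lebesgue_on unit_disk) (\<lambda>z. \<phi> z *\<^sub>R L (fx z))"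
      using commute[OF loc(1) c(2) t z(1)] commute[OF loc(2) c(1) t z(3)]
      by (simp only: eq(1) L.neg)
    show "integral\<^sup>L (lebesgue_on unit_disk) (\<lambda>z. \<phi>y z *\<^sub>R L (f z)) =
          - integral\<^sup>L (lebesgue_on unit_disk) (\<lambda>z. \<phi> z *\<^sub>R L (fy z))"
      using commute[OF loc(1) c(3) t z(2)] commute[OF loc(3) c(1) t z(3)]
      by (simp only: eq(2) L.neg)
  qed
qed

lemma has_partials_bounded_linear:
  fixes L :: "'a::euclidean_space \<Rightarrow> 'b::euclidean_space"
  assumes "bounded_linear L" "has_partials s f fx fy"
  shows "has_partials s (\<lambda>z. L (f z)) (\<lambda>z. L (fx z)) (\<lambda>z. L (fy z))"
  using assms pointwise_partials_bounded_linear weak_partials_bounded_linear by (cases s) auto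

lemma holds_on_disk_mono:
  assumes "holds_on_disk s P" "\<And>z. P z \<Longrightarrow> Q z"
  shows "holds_on_disk s Q"
  using assms by (cases s) auto

section \<open>Splitting the equation\<close>

text \<open>\<open>bc_plus\<close> sends j to \<open>-\<i>\<close>, so its composite
  \<open>?L\<close> with conjugation sends j to \<open>\<i>\<close>. As \<open>?L\<close> is
  real-linear and multiplicative, it carries \<open>bc_dbar\<close> to \<open>d_zbar\<close> and
  \<open>bc_d\<close> to \<open>d_z\<close> of the image partials.\<close>

lemma solves_beltrami_bc_plus:
  assumes "solves_bc_beltrami s \<mu> w"
  shows "solves_beltrami s (\<lambda>z. cnj (bc_plus (\<mu> z))) (\<lambda>z. cnj (bc_plus (w z)))"
proof -
  obtain wx wy where p: "has_partials s w wx wy"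
    and h: "holds_on_disk s (\<lambda>z. bc_dbar wx wy z = \<mu> z * bc_d wx wy z)"
    using assms by (auto simp: solves_bc_beltrami_def)
  let ?L = "\<lambda>u. cnj (bc_plus u)"
  have "holds_on_disk s (\<lambda>z. d_zbar (\<lambda>z. ?L (wx z)) (\<lambda>z. ?L (wy z)) z
      = ?L (\<mu> z) * d_z (\<lambda>z. ?L (wx z)) (\<lambda>z. ?L (wy z)) z)"
  proof (rule holds_on_disk_mono[OF h])
    fix z assume "bc_dbar wx wy z = \<mu> z * bc_d wx wy z"
    then have "?L (bc_dbar wx wy z) = ?L (\<mu> z * bc_d wx wy z)" by simp
    then show "d_zbar (\<lambda>z. ?L (wx z)) (\<lambda>z. ?L (wy z)) z
      = ?L (\<mu> z) * d_z (\<lambda>z. ?L (wx z)) (\<lambda>z. ?L (wy z)) z"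
      by (simp add: bc_dbar_def bc_d_def d_zbar_def d_z_def bc_components_simps)
  qed
  moreover have "bounded_linear ?L"
    using bounded_linear_compose[OF bounded_linear_cnj bounded_linear_bc_plus] .
  ultimately show ?thesis
    using has_partials_bounded_linear[OF _ p] unfolding solves_beltrami_def by blast
qed

text \<open>Here j already goes to \<open>\<i>\<close>, so the same argument runs without
  conjugation.\<close>

lemma solves_beltrami_bc_minus:
  assumes "solves_bc_beltrami s \<mu> w"
  shows "solves_beltrami s (\<lambda>z. bc_minus (\<mu> z)) (\<lambda>z. bc_minus (w z))"
proof -
  obtain wx wy where p: "has_partials s w wx wy"
    and h: "holds_on_disk s (\<lambda>z. bc_dbar wx wy z = \<mu> z * bc_d wx wy z)"
    using assms by (auto simp: solves_bc_beltrami_def)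
  let ?L = bc_minus
  have "holds_on_disk s (\<lambda>z. d_zbar (\<lambda>z. ?L (wx z)) (\<lambda>z. ?L (wy z)) z
      = ?L (\<mu> z) * d_z (\<lambda>z. ?L (wx z)) (\<lambda>z. ?L (wy z)) z)"
  proof (rule holds_on_disk_mono[OF h])
    fix z assume "bc_dbar wx wy z = \<mu> z * bc_d wx wy z"
    then have "?L (bc_dbar wx wy z) = ?L (\<mu> z * bc_d wx wy z)" by simp
    then show "d_zbar (\<lambda>z. ?L (wx z)) (\<lambda>z. ?L (wy z)) z
      = ?L (\<mu> z) * d_z (\<lambda>z. ?L (wx z)) (\<lambda>z. ?L (wy z)) z"
      by (simp add: bc_dbar_def bc_d_def d_zbar_def d_z_def bc_components_simps)
  qed
  then show ?thesis
    using has_partials_bounded_linear[OF bounded_linear_bc_minus p]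
    unfolding solves_beltrami_def by blast
qed

text \<open>The norm averages the two squared moduli, so each component of \<open>\<mu>\<close>
  inherits only the bound \<open>sqrt 2 * c\<close>; this is why the ellipticity of the two
  coefficients is stated conditionally.\<close>

theorem proposition3p2:
  fixes \<mu> w :: "complex \<Rightarrow> bicomplex" and c :: real and s :: solution_sense
  assumes "\<mu> \<in> Linf_disk" and "Linf_norm \<mu> \<le> c" and "c < 1"
    and "solves_bc_beltrami s \<mu> w"
  shows "(\<forall>z\<in>unit_disk. w z = p_plus * bc_of_complex (bc_plus (w z)) +
                              p_minus * bc_of_complex (bc_minus (w z))) \<and>
    solves_beltrami s (\<lambda>z. cnj (bc_plus (\<mu> z))) (\<lambda>z. cnj (bc_plus (w z))) \<and>
    solves_beltrami s (\<lambda>z. bc_minus (\<mu> z)) (\<lambda>z. bc_minus (w z)) \<and>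
    (\<lambda>z. cnj (bc_plus (\<mu> z))) \<in> Linf_disk \<and>
    Linf_norm (\<lambda>z. cnj (bc_plus (\<mu> z))) \<le> sqrt 2 * c \<and>
    (\<lambda>z. bc_minus (\<mu> z)) \<in> Linf_disk \<and>
    Linf_norm (\<lambda>z. bc_minus (\<mu> z)) \<le> sqrt 2 * c \<and>
    (sqrt 2 * c < 1 \<longrightarrow>
       beltrami_coefficient (\<lambda>z. cnj (bc_plus (\<mu> z))) \<and>
       beltrami_coefficient (\<lambda>z. bc_minus (\<mu> z)))"
proof -
  have mem: "(\<lambda>z. cnj (bc_plus (\<mu> z))) \<in> Linf_disk" "(\<lambda>z. bc_minus (\<mu> z)) \<in> Linf_disk"
    using Linf_disk_bounded_linear[OF bounded_linear_compose[OF bounded_linear_cnj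
          bounded_linear_bc_plus] assms(1)]
      Linf_disk_bounded_linear[OF bounded_linear_bc_minus assms(1)] by auto
  \<comment> \<open>Conjugation preserves the modulus, so both coefficients get the factor
    \<open>sqrt 2\<close>.\<close>
  have "Linf_norm (\<lambda>z. cnj (bc_plus (\<mu> z))) \<le> sqrt 2 * Linf_norm \<mu>"
    "Linf_norm (\<lambda>z. bc_minus (\<mu> z)) \<le> sqrt 2 * Linf_norm \<mu>"
    by (intro Linf_norm_mono[OF assms(1)]; simp add: cmod_bc_plus_le cmod_bc_minus_le)+
  moreover have "sqrt 2 * Linf_norm \<mu> \<le> sqrt 2 * c"
    using assms(2) by simp
  ultimately have le: "Linf_norm (\<lambda>z. cnj (bc_plus (\<mu> z))) \<le> sqrt 2 * c"
    "Linf_norm (\<lambda>z. bc_minus (\<mu> z)) \<le> sqrt 2 * c"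
    by linarith+
  show ?thesis
    using bc_decomposition solves_beltrami_bc_plus[OF assms(4)] solves_beltrami_bc_minus[OF assms(4)]
      mem le beltrami_coefficientI[OF mem(1) le(1)] beltrami_coefficientI[OF mem(2) le(2)]
    by blast
qed

end
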